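(* Consider a CAV (vehicle $1$) and one trailing HDV (vehicle $2$), with $v_1(t^c)=v_2(t^c)=v_{\max}$ and $\delta_2(t^c)>0$. Suppose the CAV is to complete the platoon transition step with HDV $2$ using the control input $u_1(t)=u_p$, $t\in[t^c,t^s]$, within a control zone of length $L_c$. Then a platoon transition duration $\tau^t>0$ is feasible if $$\max\left\{\left(\frac{-2\delta_2(t^c)}{u_{\min}}\right)^{1/2},\ \frac{2\delta_2(t^c)}{v_1(t^c)-v_{\min}}\right\}\ \le\ \tau^t\ \le\ \frac{\phi_1+\sqrt{\phi_1^2+4\phi_2}}{2},$$ where $$\phi_1=\frac{L_c+\delta_2(t^c)-v_1(t^c)\,(\tau^r+\bar\eta)}{v_1(t^c)},\qquad \phi_2=\frac{2\delta_2(t^c)\,(\tau^r+\bar\eta)}{v_1(t^c)} .$$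
   Context: Vehicles $1$ (a connected and automated vehicle, CAV) and $2$ (a human-driven vehicle, HDV, directly behind vehicle $1$) travel on a single lane with $\dot p_i=v_i$, $\dot v_i=u_i$, where $p_i$ is the front-bumper position, $v_i$ the speed and $u_i$ the acceleration of vehicle $i$. They are subject to $0<v_{\min}\le v_i(t)\le v_{\max}$ and $u_{\min}\le u_i(t)\le u_{\max}$, where $v_{\min}<v_{\max}$ and $u_{\min}<0\le u_{\max}$. The CAV enters the control zone, of length $L_c>0$, at time $t^c$ and exits it at time $t^f$. All vehicles have length $l_c$. Dynamic following spacing: $s_2(t)=\rho_2 v_2(t)+s_0$, with $\rho_2$ the desired time gap and $s_0$ the standstill distance. Platoon gap: $\delta_2(t)=p_1(t)-p_2(t)-s_2(t)-l_c$. While $\delta_2(t)>0$ the HDV is in decoupled free-flow mode and travels with $v_2(t)=v_{\max}$. CAV control: $u_1(t)=u_p$ for $t\in[t^c,t^s]$ and $u_1(t)=0$ for $t\in(t^s,t^f]$, with $u_p\in[u_{\min},0)$. The platoon transition step is completed at the time $t^s=t^c+\tau^t$ at which $\delta_2(t^s)=0$; $\tau^t$ is the platoon transition duration, and it determines $u_p$ through $2\delta_2(t^c)+u_p(\tau^t)^2=0$. The subsequent platoon stabilization step has the given duration $\tau^s=\tau^r+\bar\eta$, where $\tau^r\ge0$ is the driver response time and $\bar\eta\ge0$ an upper bound on the driver's perception delay; the platoon formation time is $t^p=t^c+\tau^t+\tau^s$. $\tau^t$ is called feasible if the corresponding $u_p$ satisfies $u_p\in[u_{\min},0)$, the resulting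 CAV trajectory satisfies the speed and acceleration bounds above, and platoon formation is completed within the control zone, i.e. $p_1(t^p)-p_1(t^c)\le L_c$. *)

theory Defs
  imports "HOL-Analysis.Analysis"
begin

record params =
  v_min :: real
  v_max :: real
  u_min :: real
  u_max :: real
  time_gap :: real         \<comment> \<open>\<open>\<rho>\<^sub>2\<close>\<close>
  standstill :: real       \<comment> \<open>\<open>s\<^sub>0\<close>\<close>
  veh_length :: real       \<comment> \<open>\<open>l\<^sub>c\<close>\<close>
  zone_length :: real      \<comment> \<open>\<open>L\<^sub>c\<close>\<close>
  response_time :: real    \<comment> \<open>\<open>\<tau>\<^sup>r\<close>\<close>
  delay_bound :: real      \<comment> \<open>upper bound on the perception delay\<close>

definition stabilization_duration :: "params \<Rightarrow> real" where
  "stabilization_duration P = response_time P + delay_bound P"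

definition following_spacing :: "params \<Rightarrow> real \<Rightarrow> real" where
  "following_spacing P v = time_gap P * v + standstill P"

text \<open>The platoon gap \<open>\<delta>\<^sub>2\<close> as a function of the instantaneous values \<open>x1 = p\<^sub>1(t)\<close>,
  \<open>x2 = p\<^sub>2(t)\<close>, \<open>w2 = v\<^sub>2(t)\<close>.\<close>

definition platoon_gap :: "params \<Rightarrow> real \<Rightarrow> real \<Rightarrow> real \<Rightarrow> real" where
  "platoon_gap P x1 x2 w2 = x1 - x2 - following_spacing P w2 - veh_length P"

text \<open>The dynamics \<open>p' = v\<close>, \<open>v' = u\<close> on \<open>{a..b}\<close>. The input may jump (the CAV's does, at the end of
  the transition step), so \<open>v\<close> is continuous and \<open>v' = u\<close> may fail at finitely many instants.\<close>

definition vehicle_dynamics ::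
  "real \<Rightarrow> real \<Rightarrow> (real \<Rightarrow> real) \<Rightarrow> (real \<Rightarrow> real) \<Rightarrow> (real \<Rightarrow> real) \<Rightarrow> bool" where
  "vehicle_dynamics a b p v u \<longleftrightarrow>
     (\<forall>t\<in>{a..b}. (p has_real_derivative v t) (at t within {a..b})) \<and>
     continuous_on {a..b} v \<and>
     (\<exists>S. finite S \<and> (\<forall>t\<in>{a..b} - S. (v has_real_derivative u t) (at t within {a..b})))"

definition within_bounds ::
  "params \<Rightarrow> real \<Rightarrow> real \<Rightarrow> (real \<Rightarrow> real) \<Rightarrow> (real \<Rightarrow> real) \<Rightarrow> bool" where
  "within_bounds P a b v u \<longleftrightarrow>
     (\<forall>t\<in>{a..b}. v_min P \<le> v t \<and> v t \<le> v_max P \<and> u_min P \<le> u t \<and> u t \<le> u_max P)"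

definition cav_control :: "real \<Rightarrow> real \<Rightarrow> real \<Rightarrow> real" where
  "cav_control up ts t = (if t \<le> ts then up else 0)"

definition exit_time :: "params \<Rightarrow> real \<Rightarrow> (real \<Rightarrow> real) \<Rightarrow> real \<Rightarrow> bool" where
  "exit_time P tc p1 tf \<longleftrightarrow>
     tc < tf \<and> p1 tf - p1 tc = zone_length P \<and> (\<forall>t\<in>{tc..<tf}. p1 t - p1 tc < zone_length P)"

text \<open>Motion of the two vehicles on \<open>{tc..tf}\<close> from the initial state \<open>(x1, w1)\<close>, \<open>(x2, w2)\<close>, under
  the CAV control with deceleration \<open>up\<close> until \<open>ts\<close>. The HDV is only prescribed in free-flow mode;
  once the gap is closed its input \<open>u2\<close> is arbitrary within the bounds. The bounds are not imposed on
  the CAV here, since whether it satisfies them is part of feasibility.\<close>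

definition motion ::
  "params \<Rightarrow> real \<Rightarrow> real \<Rightarrow> real \<Rightarrow> real \<Rightarrow> real \<Rightarrow> real \<Rightarrow> real \<Rightarrow> real \<Rightarrow>
   (real \<Rightarrow> real) \<Rightarrow> (real \<Rightarrow> real) \<Rightarrow> (real \<Rightarrow> real) \<Rightarrow> (real \<Rightarrow> real) \<Rightarrow> (real \<Rightarrow> real) \<Rightarrow> bool" where
  "motion P tc x1 w1 x2 w2 up ts tf p1 v1 p2 v2 u2 \<longleftrightarrow>
     p1 tc = x1 \<and> v1 tc = w1 \<and> p2 tc = x2 \<and> v2 tc = w2 \<and>
     exit_time P tc p1 tf \<and>
     vehicle_dynamics tc tf p1 v1 (cav_control up ts) \<and>
     vehicle_dynamics tc tf p2 v2 u2 \<and>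
     within_bounds P tc tf v2 u2 \<and>
     (\<forall>t\<in>{tc..tf}. platoon_gap P (p1 t) (p2 t) (v2 t) > 0 \<longrightarrow> v2 t = v_max P)"

text \<open>Feasibility of a transition duration \<open>\<tau> > 0\<close>. The motion determined by \<open>\<tau>\<close> (unique on
  \<open>{tc..tf}\<close> as far as the CAV is concerned) must exist, and every such motion must have the
  required properties. Trajectories are meaningful on \<open>{tc..tf}\<close> only, hence the explicit
  \<open>tp \<le> tf\<close> next to the travelled-distance condition.\<close>

definition feasible ::
  "params \<Rightarrow> real \<Rightarrow> real \<Rightarrow> real \<Rightarrow> real \<Rightarrow> real \<Rightarrow> real \<Rightarrow> bool" where
  "feasible P tc x1 w1 x2 w2 \<tau> \<longleftrightarrow>
     (let ts = tc + \<tau>; tp = tc + \<tau> + stabilization_duration P in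
      \<exists>up. 2 * platoon_gap P x1 x2 w2 + up * \<tau>\<^sup>2 = 0 \<and>
        u_min P \<le> up \<and> up < 0 \<and>
        (\<exists>tf p1 v1 p2 v2 u2. motion P tc x1 w1 x2 w2 up ts tf p1 v1 p2 v2 u2) \<and>
        (\<forall>tf p1 v1 p2 v2 u2. motion P tc x1 w1 x2 w2 up ts tf p1 v1 p2 v2 u2 \<longrightarrow>
           platoon_gap P (p1 ts) (p2 ts) (v2 ts) = 0 \<and>
           within_bounds P tc tf v1 (cav_control up ts) \<and>
           tp \<le> tf \<and> p1 tp - p1 tc \<le> zone_length P))"

end

theory Submission imports Defs begin

text \<open>
  Write \<open>V = v_max\<close>, \<open>\<sigma>\<close> for the stabilization duration and \<open>up = - 2\<delta> / \<tau>\<^sup>2\<close> for the deceleration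
  that \<open>\<tau>\<close> determines. In the frame moving with speed \<open>V\<close> the HDV is at rest while the gap is open
  and the CAV falls back by \<open>- up s\<^sup>2 / 2\<close>, so the gap is \<open>\<delta> + up s\<^sup>2 / 2\<close> and closes exactly at
  \<open>s = \<tau>\<close>. Each hypothesis on \<open>\<tau>\<close> then encodes one requirement.

  \<^item> \<open>\<tau> \<ge> sqrt (- 2\<delta> / u_min)\<close> says \<open>up \<ge> u_min\<close>.
  \<^item> The lowest speed of the CAV is \<open>V + up \<tau> = V - 2\<delta> / \<tau>\<close>, and \<open>\<tau> \<ge> 2\<delta> / (V - v_min)\<close> keeps it
    at \<open>v_min\<close> or above.
  \<^item> By the formation time the CAV has travelled \<open>V (\<tau> + \<sigma>) - \<delta> - 2\<delta>\<sigma> / \<tau>\<close>. Multiplying by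
    \<open>\<tau> / V\<close> shows that this is at most the zone length iff \<open>\<tau>\<^sup>2 \<le> \<phi>1 \<tau> + \<phi>2\<close>. As \<open>\<phi>2 \<ge> 0\<close>, the roots
    of the quadratic have opposite signs (or one vanishes), so for \<open>\<tau> > 0\<close> only the upper root
    matters.

  Feasibility speaks about every motion, so these closed forms must be forced by the dynamics.
  For the CAV this is uniqueness of solutions (\<open>vehicle_dynamics_unique\<close>). For the HDV the free-flow
  rule is conditional on the gap itself, which calls for a first-crossing-time argument
  (\<open>gap_closes_at_transition_end\<close>). For existence it suffices to let the HDV keep speed \<open>V\<close>
  forever, which complies with the rule whatever the gap is.
\<close>

section \<open>Uniqueness of trajectories\<close>

lemma equal_derivatives_imp_equal:
  fixes f g d :: "real \<Rightarrow> real"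
  assumes "finite S" "continuous_on {a..b} f" "continuous_on {a..b} g" "f a = g a"
    and "\<And>t. t \<in> {a..b} - S \<Longrightarrow> (f has_real_derivative d t) (at t within {a..b})"
    and "\<And>t. t \<in> {a..b} - S \<Longrightarrow> (g has_real_derivative d t) (at t within {a..b})"
    and "t \<in> {a..b}"
  shows "f t = g t"
proof -
  let ?h = "\<lambda>x. f x - g x"
  have "(?h has_derivative (\<lambda>h. 0)) (at x within {a..b})" if "x \<in> {a..b} - S" for x
    using DERIV_diff[OF assms(5,6)[OF that]]
    by (simp add: has_field_derivative_def lambda_zero)
  moreover have "continuous_on {a..b} ?h"
    using assms(2,3) by (rule continuous_on_diff)
  moreover have "?h a = 0"
    using assms(4) by simp
  ultimately have "?h t = 0"
    using has_derivative_zero_unique_strong_interval[of S a b ?h 0 t] assms(1,7) by blast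
  then show ?thesis by simp
qed

lemma position_unique:
  fixes p q v :: "real \<Rightarrow> real"
  assumes "\<And>t. t \<in> {a..b} \<Longrightarrow> (p has_real_derivative v t) (at t within {a..b})"
    and "\<And>t. t \<in> {a..b} \<Longrightarrow> (q has_real_derivative v t) (at t within {a..b})"
    and "p a = q a" and "t \<in> {a..b}"
  shows "p t = q t"
proof (rule equal_derivatives_imp_equal[where f = p and g = q and S = "{}" and d = v and a = a and b = b])
  show "continuous_on {a..b} p"
    using assms(1) by (rule DERIV_continuous_on)
  show "continuous_on {a..b} q"
    using assms(2) by (rule DERIV_continuous_on)
  show "(p has_real_derivative v s) (at s within {a..b})" if "s \<in> {a..b} - {}" for s
    using assms(1) that by simp
  show "(q has_real_derivative v s) (at s within {a..b})" if "s \<in> {a..b} - {}" for s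
    using assms(2) that by simp
qed (use assms(3,4) in \<open>simp_all only: finite.emptyI\<close>)

text \<open>The speeds agree first: both follow the input outside a finite set, and continuity bridges the
  exceptional instants. The positions then have a common derivative everywhere.\<close>

lemma vehicle_dynamics_unique:
  assumes dyn: "vehicle_dynamics a b p v u" "vehicle_dynamics a b q w u"
    and init: "p a = q a" "v a = w a" and t: "t \<in> {a..b}"
  shows "v t = w t" and "p t = q t"
proof -
  obtain S T where "finite S" "finite T"
    and S: "\<And>t. t \<in> {a..b} - S \<Longrightarrow> (v has_real_derivative u t) (at t within {a..b})"
    and T: "\<And>t. t \<in> {a..b} - T \<Longrightarrow> (w has_real_derivative u t) (at t within {a..b})"
    using dyn unfolding vehicle_dynamics_def by blast
  have speed: "v t = w t" if "t \<in> {a..b}" for t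
    by (rule equal_derivatives_imp_equal[where f = v and g = w and S = "S \<union> T" and d = u and a = a and b = b])
      (use \<open>finite S\<close> \<open>finite T\<close> S T dyn init that in \<open>auto simp: vehicle_dynamics_def\<close>)
  then show "v t = w t" using t .
  show "p t = q t"
  proof (rule position_unique[where p = p and q = q and v = v and a = a and b = b])
    fix s assume s: "s \<in> {a..b}"
    show "(p has_real_derivative v s) (at s within {a..b})"
      using dyn(1) s by (simp add: vehicle_dynamics_def)
    show "(q has_real_derivative v s) (at s within {a..b})"
      using dyn(2) s speed[OF s] by (simp add: vehicle_dynamics_def)
  qed (use init t in simp_all)
qed

section \<open>The closed-form trajectory of the CAV\<close>

definition cav_speed :: "real \<Rightarrow> real \<Rightarrow> real \<Rightarrow> real \<Rightarrow> real" where
  "cav_speed w up \<tau> s = w + up * min s \<tau>"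

text \<open>Subtracting \<open>(max 0 (s - \<tau>))\<^sup>2\<close> turns the parabola into its tangent line for \<open>s \<ge> \<tau>\<close>; this form
  is differentiable without a case distinction at the switching instant.\<close>

definition cav_travel :: "real \<Rightarrow> real \<Rightarrow> real \<Rightarrow> real \<Rightarrow> real" where
  "cav_travel w up \<tau> s = w * s + up * (s\<^sup>2 - (max 0 (s - \<tau>))\<^sup>2) / 2"

lemma cav_travel_before: "s \<le> \<tau> \<Longrightarrow> cav_travel w up \<tau> s = w * s + up * s\<^sup>2 / 2"
  by (simp add: cav_travel_def)

lemma cav_travel_after:
  "r \<ge> 0 \<Longrightarrow> cav_travel w up \<tau> (\<tau> + r) = w * \<tau> + up * \<tau>\<^sup>2 / 2 + (w + up * \<tau>) * r"
  by (simp add: cav_travel_def power2_eq_square field_simps)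

lemma has_real_derivative_positive_part_squared:
  "((\<lambda>x::real. (max 0 x)\<^sup>2) has_real_derivative 2 * max 0 x) (at x)"
proof -
  consider "x < 0" | "x = 0" | "x > 0" by linarith
  then show ?thesis
  proof cases
    case 1
    have "((\<lambda>x. 0) has_real_derivative 2 * max 0 x) (at x)"
      using 1 by simp
    then show ?thesis
      by (rule has_field_derivative_transform_within_open[where S = "{..<0}"]) (use 1 in auto)
  next
    case 2
    \<comment> \<open>at the kink the difference quotient is \<open>max 0 h\<close>, which vanishes with \<open>h\<close>\<close>
    have "(\<lambda>h::real. (max 0 h)\<^sup>2 / h) = (\<lambda>h. max 0 h)"
      by (rule ext) (simp add: max_def power2_eq_square)
    moreover have "((\<lambda>h::real. max 0 h) \<longlongrightarrow> max 0 0) (at 0)"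
      by (intro tendsto_intros)
    ultimately show ?thesis
      using 2 by (simp add: DERIV_def)
  next
    case 3
    have "((\<lambda>x. x\<^sup>2) has_real_derivative 2 * max 0 x) (at x)"
      using 3 by (auto intro!: derivative_eq_intros)
    then show ?thesis
      by (rule has_field_derivative_transform_within_open[where S = "{0<..}"]) (use 3 in auto)
  qed
qed

lemma cav_travel_derivative:
  "(cav_travel w up \<tau> has_real_derivative cav_speed w up \<tau> s) (at s)"
proof -
  define h where "h s = (max 0 (s - \<tau>))\<^sup>2" for s
  have "(h has_real_derivative 2 * max 0 (s - \<tau>) * 1) (at s)"
    unfolding h_def
    by (rule DERIV_chain2[OF has_real_derivative_positive_part_squared])
      (auto intro!: derivative_eq_intros)
  then have "((\<lambda>s. w * s + up * (s\<^sup>2 - h s) / 2) has_real_derivative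
      w + up * (2 * s - 2 * max 0 (s - \<tau>)) / 2) (at s)"
    by (auto intro!: derivative_eq_intros)
  moreover have "w + up * (2 * s - 2 * max 0 (s - \<tau>)) / 2 = cav_speed w up \<tau> s"
    by (simp add: cav_speed_def min_def max_def)
  ultimately show ?thesis
    by (simp add: cav_travel_def[abs_def] h_def)
qed

lemma cav_speed_derivative:
  assumes "s \<noteq> \<tau>"
  shows "(cav_speed w up \<tau> has_real_derivative cav_control up \<tau> s) (at s)"
proof (cases "s < \<tau>")
  case True
  have "((\<lambda>s. w + up * s) has_real_derivative cav_control up \<tau> s) (at s)"
    using True by (auto intro!: derivative_eq_intros simp: cav_control_def)
  then show ?thesis
    by (rule has_field_derivative_transform_within_open[where S = "{..<\<tau>}"])
      (use True in \<open>auto simp: cav_speed_def\<close>)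
next
  case False
  have "((\<lambda>s. w + up * \<tau>) has_real_derivative cav_control up \<tau> s) (at s)"
    using False assms by (simp add: cav_control_def)
  then show ?thesis
    by (rule has_field_derivative_transform_within_open[where S = "{\<tau><..}"])
      (use False assms in \<open>auto simp: cav_speed_def\<close>)
qed

lemma cav_dynamics:
  "vehicle_dynamics a b (\<lambda>t. x + cav_travel w up \<tau> (t - tc)) (\<lambda>t. cav_speed w up \<tau> (t - tc))
     (cav_control up (tc + \<tau>))"
proof -
  have shift: "((\<lambda>t. t - tc) has_real_derivative 1) (at t)" for t
    by (auto intro!: derivative_eq_intros)
  have "((\<lambda>t. x + cav_travel w up \<tau> (t - tc)) has_real_derivative cav_speed w up \<tau> (t - tc)) (at t)"
    for t
    using DERIV_add[OF DERIV_const DERIV_chain2[OF cav_travel_derivative shift]] by simp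
  moreover have "((\<lambda>t. cav_speed w up \<tau> (t - tc)) has_real_derivative cav_control up (tc + \<tau>) t) (at t)"
    if "t \<noteq> tc + \<tau>" for t
  proof -
    have "((\<lambda>t. cav_speed w up \<tau> (t - tc)) has_real_derivative cav_control up \<tau> (t - tc) * 1) (at t)"
      by (rule DERIV_chain2[OF cav_speed_derivative shift]) (use that in auto)
    then show ?thesis
      by (simp add: cav_control_def algebra_simps)
  qed
  moreover have "continuous_on {a..b} (\<lambda>t. cav_speed w up \<tau> (t - tc))"
    unfolding cav_speed_def by (intro continuous_intros)
  ultimately show ?thesis
    unfolding vehicle_dynamics_def
    by (auto intro: has_field_derivative_at_within intro!: exI[of _ "{tc + \<tau>}"])
qed

lemma cav_speed_bounds:
  assumes "up \<le> 0" "0 \<le> s" "0 \<le> \<tau>"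
  shows "w + up * \<tau> \<le> cav_speed w up \<tau> s" and "cav_speed w up \<tau> s \<le> w"
  using assms
  by (simp_all add: cav_speed_def mult_left_mono_neg mult_nonpos_nonneg)

lemma cav_travel_strict_mono:
  assumes "up \<le> 0" "0 \<le> \<tau>" "0 < w + up * \<tau>" "0 \<le> s" "s < s'"
  shows "cav_travel w up \<tau> s < cav_travel w up \<tau> s'"
proof (rule DERIV_pos_imp_increasing[OF \<open>s < s'\<close>])
  fix r assume "s \<le> r" "r \<le> s'"
  then have "0 < cav_speed w up \<tau> r"
    using cav_speed_bounds(1)[of up r \<tau> w] assms by simp
  then show "\<exists>y. (cav_travel w up \<tau> has_real_derivative y) (at r) \<and> y > 0"
    using cav_travel_derivative by blast
qed

section \<open>Closing of the platoon gap\<close>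

text \<open>The gap involves the HDV's speed at the same instant, so knowing that speed up to, but excluding,
  \<open>t\<close> suffices only because speeds are continuous.\<close>

lemma free_flow_until:
  assumes dyn: "vehicle_dynamics a b p v u"
    and t: "a < t" "t \<le> b"
    and free: "\<And>s. s \<in> {a..<t} \<Longrightarrow> v s = V"
  shows "v t = V" and "p t = p a + V * (t - a)"
proof -
  have sub: "{a..t} \<subseteq> {a..b}" using t by auto
  have closure: "closure {a..<t} = {a..t}" using t by simp
  have "continuous_on {a..b} v" using dyn by (simp add: vehicle_dynamics_def)
  then have "continuous_on (closure {a..<t}) v"
    unfolding closure using sub by (rule continuous_on_subset)
  then have speed: "v s = V" if "s \<in> {a..t}" for s
    using continuous_constant_on_closure[of "{a..<t}" v V s] free that by (simp add: closure)
  then show "v t = V" using t by simp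
  show "p t = p a + V * (t - a)"
  proof (rule position_unique[where p = p and v = v and a = a and b = t])
    fix s assume s: "s \<in> {a..t}"
    have "(p has_real_derivative v s) (at s within {a..b})"
      using dyn s sub by (auto simp: vehicle_dynamics_def)
    then show "(p has_real_derivative v s) (at s within {a..t})"
      using sub by (rule DERIV_subset)
    show "((\<lambda>s. p a + V * (s - a)) has_real_derivative v s) (at s within {a..t})"
      using speed[OF s] by (auto intro!: derivative_eq_intros)
  qed (use t in auto)
qed

text \<open>A first instant \<open>t\<close> with nonpositive gap before the end of the transition would be preceded by
  free flow only. The free-flow gap formula then holds at \<open>t\<close> as well, and it is still positive there.
  So the HDV is in free flow throughout the transition, and the formula gives gap \<open>0\<close> at its end.\<close>

lemma gap_closes_at_transition_end:
  fixes P :: params and p1 v1 p2 v2 u2 :: "real \<Rightarrow> real"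
  assumes hdv: "vehicle_dynamics tc tf p2 v2 u2"
    and rule: "\<And>t. t \<in> {tc..tf} \<Longrightarrow> platoon_gap P (p1 t) (p2 t) (v2 t) > 0 \<Longrightarrow> v2 t = V"
    and cav: "\<And>t. t \<in> {tc..tc + \<tau>} \<Longrightarrow> p1 t = p1 tc + V * (t - tc) + up * (t - tc)\<^sup>2 / 2"
    and init: "v2 tc = V" "platoon_gap P (p1 tc) (p2 tc) (v2 tc) = \<delta>"
    and up: "2 * \<delta> + up * \<tau>\<^sup>2 = 0" "up < 0"
    and \<tau>: "0 < \<tau>" "tc + \<tau> \<le> tf"
  shows "platoon_gap P (p1 (tc + \<tau>)) (p2 (tc + \<tau>)) (v2 (tc + \<tau>)) = 0"
proof -
  let ?g = "\<lambda>t. platoon_gap P (p1 t) (p2 t) (v2 t)"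
  have "up * \<tau>\<^sup>2 < 0" using up(2) \<tau>(1) by (simp add: mult_neg_pos)
  then have "\<delta> > 0" using up(1) by linarith
  have sub: "{tc..tc + \<tau>} \<subseteq> {tc..tf}" using \<tau> by auto
  have formula: "?g t = \<delta> + up * (t - tc)\<^sup>2 / 2"
    if "tc < t" "t \<le> tc + \<tau>" and pos: "\<And>s. s \<in> {tc..<t} \<Longrightarrow> ?g s > 0" for t
  proof -
    have "v2 s = V" if "s \<in> {tc..<t}" for s
      using rule[of s] pos[of s] that \<open>t \<le> tc + \<tau>\<close> \<tau> by auto
    then have "v2 t = V" "p2 t = p2 tc + V * (t - tc)"
      using free_flow_until[OF hdv \<open>tc < t\<close>] that \<tau> by auto
    then show ?thesis
      using cav[of t] init that(1,2)
      by (simp add: platoon_gap_def)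
  qed
  have "?g t > 0" if t: "t \<in> {tc..<tc + \<tau>}" for t
  proof (rule ccontr)
    assume "\<not> ?g t > 0"
    let ?A = "{s \<in> {tc..tc + \<tau>}. ?g s \<le> 0}"
    have "continuous_on {tc..tc + \<tau>} (\<lambda>s. p1 tc + V * (s - tc) + up * (s - tc)\<^sup>2 / 2)"
      by (intro continuous_intros) simp
    then have "continuous_on {tc..tc + \<tau>} p1"
      by (rule continuous_on_eq) (rule cav[symmetric])
    moreover have "continuous_on {tc..tf} p2"
      using hdv by (intro DERIV_continuous_on[where D = v2]) (simp add: vehicle_dynamics_def)
    then have "continuous_on {tc..tc + \<tau>} p2"
      using sub by (rule continuous_on_subset)
    moreover have "continuous_on {tc..tf} v2"
      using hdv by (simp add: vehicle_dynamics_def)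
    then have "continuous_on {tc..tc + \<tau>} v2"
      using sub by (rule continuous_on_subset)
    ultimately have "continuous_on {tc..tc + \<tau>} ?g"
      unfolding platoon_gap_def following_spacing_def
      by (intro continuous_intros)
    then have "closed ?A"
      by (rule continuous_on_closed_Collect_le[OF _ continuous_on_const]) simp
    moreover have "bounded ?A"
      by (rule bounded_subset[of "{tc..tc + \<tau>}"]) auto
    ultimately have "compact ?A"
      by (simp add: compact_eq_bounded_closed)
    moreover have "t \<in> ?A" using t \<open>\<not> ?g t > 0\<close> by auto
    ultimately obtain t0 where t0: "t0 \<in> ?A" and first: "\<And>s. s \<in> ?A \<Longrightarrow> t0 \<le> s"
      using compact_attains_inf[of ?A] by blast
    have "t0 < tc + \<tau>" using first[OF \<open>t \<in> ?A\<close>] t by simp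
    have "t0 \<noteq> tc" using t0 init \<open>\<delta> > 0\<close> by auto
    then have "tc < t0" using t0 by auto
    have "?g s > 0" if "s \<in> {tc..<t0}" for s
      using first[of s] that t0 by force
    then have gap: "?g t0 = \<delta> + up * (t0 - tc)\<^sup>2 / 2"
      using formula[of t0] \<open>tc < t0\<close> \<open>t0 < tc + \<tau>\<close> by simp
    have "(t0 - tc)\<^sup>2 < \<tau>\<^sup>2"
      using \<open>tc < t0\<close> \<open>t0 < tc + \<tau>\<close> by (intro power_strict_mono) auto
    then have "up * \<tau>\<^sup>2 < up * (t0 - tc)\<^sup>2"
      using up(2) by simp
    then show False using gap up(1) t0 by auto
  qed
  then show ?thesis
    using formula[of "tc + \<tau>"] \<tau> up(1) by simp
qed

section \<open>Feasibility\<close>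

text \<open>Since \<open>c \<ge> 0\<close>, the lower root of \<open>x\<^sup>2 - b x - c\<close> is nonpositive, so a nonnegative \<open>x\<close> up to the
  upper root lies between the roots.\<close>

lemma quadratic_bound_below_upper_root:
  fixes x b c :: real
  assumes "0 \<le> x" "0 \<le> c" and upper: "x \<le> (b + sqrt (b\<^sup>2 + 4 * c)) / 2"
  shows "x\<^sup>2 \<le> b * x + c"
proof (cases "x \<le> b")
  case True
  then have "x * x \<le> b * x" using \<open>0 \<le> x\<close> by (rule mult_right_mono)
  then show ?thesis using \<open>0 \<le> c\<close> by (simp add: power2_eq_square)
next
  case False
  then have "0 \<le> 2 * x - b" using \<open>0 \<le> x\<close> by linarith
  moreover have "2 * x - b \<le> sqrt (b\<^sup>2 + 4 * c)" using upper by simp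
  ultimately have "(2 * x - b)\<^sup>2 \<le> (sqrt (b\<^sup>2 + 4 * c))\<^sup>2" by (intro power_mono) auto
  also have "\<dots> = b\<^sup>2 + 4 * c" using \<open>0 \<le> c\<close> by simp
  finally show ?thesis by (simp add: power2_eq_square algebra_simps)
qed

theorem theorem2:
  fixes P :: params and tc x1 w1 x2 w2 \<tau> \<delta> \<phi>1 \<phi>2 :: real
  assumes "0 < v_min P" and "v_min P < v_max P"
    and "u_min P < 0" and "0 \<le> u_max P"
    and "zone_length P > 0"
    and "response_time P \<ge> 0" and "delay_bound P \<ge> 0"
    and "w1 = v_max P" and "w2 = v_max P"
    and "\<delta> = platoon_gap P x1 x2 w2" and "\<delta> > 0"
    and "\<phi>1 = (zone_length P + \<delta> - w1 * (response_time P + delay_bound P)) / w1"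
    and "\<phi>2 = 2 * \<delta> * (response_time P + delay_bound P) / w1"
    and "\<tau> > 0"
    and "max (sqrt (- 2 * \<delta> / u_min P)) (2 * \<delta> / (w1 - v_min P)) \<le> \<tau>"
    and "\<tau> \<le> (\<phi>1 + sqrt (\<phi>1\<^sup>2 + 4 * \<phi>2)) / 2"
  shows "feasible P tc x1 w1 x2 w2 \<tau>"
proof -
  let ?V = "v_max P"
  define \<sigma> where "\<sigma> = stabilization_duration P"
  define up where "up = - 2 * \<delta> / \<tau>\<^sup>2"
  define low where "low = ?V + up * \<tau>"
  have w: "w1 = ?V" "w2 = ?V" and \<tau>: "\<tau> > 0" and \<delta>: "\<delta> > 0" "\<delta> = platoon_gap P x1 x2 w2"
    using assms by auto
  have V: "?V > 0" and \<sigma>: "\<sigma> \<ge> 0"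
    using assms by (auto simp: \<sigma>_def stabilization_duration_def)
  have up_eq: "2 * \<delta> + up * \<tau>\<^sup>2 = 0" and up_neg: "up < 0" and up_\<tau>: "up * \<tau> = - 2 * \<delta> / \<tau>"
    using \<tau> \<delta> by (auto simp: up_def power2_eq_square field_simps)
  have up_min: "u_min P \<le> up"
  proof -
    have "sqrt (- 2 * \<delta> / u_min P) \<le> \<tau>" using assms by simp
    then have "- 2 * \<delta> / u_min P \<le> \<tau>\<^sup>2" by (rule sqrt_le_D)
    then show ?thesis
      using \<tau> \<open>u_min P < 0\<close> by (simp add: up_def field_simps)
  qed
  have low: "v_min P \<le> low" "0 < low"
  proof -
    have "2 * \<delta> / (?V - v_min P) \<le> \<tau>" using assms by simp
    then have "2 * \<delta> / \<tau> \<le> ?V - v_min P"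
      using \<tau> \<open>v_min P < v_max P\<close> by (simp add: field_simps)
    then show "v_min P \<le> low" using up_\<tau> by (simp add: low_def)
    then show "0 < low" using \<open>0 < v_min P\<close> by linarith
  qed
  let ?d = "cav_travel ?V up \<tau>"
  have after: "?d (\<tau> + r) = ?V * \<tau> - \<delta> + low * r" if "r \<ge> 0" for r
    using cav_travel_after[OF that, of ?V up \<tau>] up_eq by (simp add: low_def)
  have formed: "?d (\<tau> + \<sigma>) \<le> zone_length P"
  proof -
    have "\<phi>2 \<ge> 0" using assms by simp
    then have "\<tau>\<^sup>2 \<le> \<phi>1 * \<tau> + \<phi>2"
      using quadratic_bound_below_upper_root[of \<tau> \<phi>2 \<phi>1] assms by simp
    moreover have "?V * \<phi>1 = zone_length P + \<delta> - ?V * \<sigma>" "?V * \<phi>2 = 2 * \<delta> * \<sigma>"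
      using assms V by (auto simp: \<sigma>_def stabilization_duration_def)
    moreover have "?V * \<tau>\<^sup>2 \<le> (?V * \<phi>1) * \<tau> + ?V * \<phi>2"
      using mult_left_mono[OF calculation(1), of ?V] V by (simp add: algebra_simps)
    ultimately have "?V * \<tau>\<^sup>2 \<le> (zone_length P + \<delta> - ?V * \<sigma>) * \<tau> + 2 * \<delta> * \<sigma>"
      by simp
    moreover have "?d (\<tau> + \<sigma>) * \<tau> = ?V * \<tau>\<^sup>2 - \<delta> * \<tau> + ?V * \<sigma> * \<tau> - 2 * \<delta> * \<sigma>"
      unfolding after[OF \<sigma>] low_def up_\<tau>
      using \<tau> by (simp add: power2_eq_square field_simps)
    ultimately have "?d (\<tau> + \<sigma>) * \<tau> \<le> zone_length P * \<tau>"
      by (simp add: algebra_simps)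
    then show ?thesis using \<tau> by simp
  qed
  have mono: "?d s < ?d s'" if "0 \<le> s" "s < s'" for s s'
    using cav_travel_strict_mono[of up \<tau> ?V s s'] up_neg \<tau> low that by (simp add: low_def)
  have d0: "?d 0 = 0" using \<tau> by (simp add: cav_travel_before)

  have existence: "\<exists>tf p1 v1 p2 v2 u2. motion P tc x1 w1 x2 w2 up (tc + \<tau>) tf p1 v1 p2 v2 u2"
  proof -
    \<comment> \<open>what remains of the zone after the transition is driven at the constant speed \<open>low\<close>\<close>
    define r where "r = (zone_length P - (?V * \<tau> - \<delta>)) / low"
    define tf where "tf = tc + (\<tau> + r)"
    let ?p1 = "\<lambda>t. x1 + ?d (t - tc)" and ?p2 = "\<lambda>t. x2 + ?V * (t - tc)"
    have "low * \<sigma> \<le> zone_length P - (?V * \<tau> - \<delta>)"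
      using formed by (simp add: after[OF \<sigma>])
    then have "\<sigma> \<le> r" using low by (simp add: r_def field_simps)
    then have "r \<ge> 0" using \<sigma> by linarith
    then have exit_dist: "?d (\<tau> + r) = zone_length P"
      using low by (simp add: after r_def)
    have "?d (t - tc) < zone_length P" if "t \<in> {tc..<tf}" for t
      using mono[of "t - tc" "\<tau> + r"] that exit_dist by (simp add: tf_def)
    then have "exit_time P tc ?p1 tf"
      using \<tau> \<open>r \<ge> 0\<close> exit_dist by (auto simp: exit_time_def tf_def d0)
    moreover have "vehicle_dynamics tc tf ?p2 (\<lambda>t. ?V) (\<lambda>t. 0)"
      unfolding vehicle_dynamics_def
      by (auto intro!: derivative_eq_intros exI[of _ "{}"])
    moreover have "within_bounds P tc tf (\<lambda>t. ?V) (\<lambda>t. 0)"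
      using assms by (auto simp: within_bounds_def)
    ultimately have "motion P tc x1 w1 x2 w2 up (tc + \<tau>) tf
        ?p1 (\<lambda>t. cav_speed ?V up \<tau> (t - tc)) ?p2 (\<lambda>t. ?V) (\<lambda>t. 0)"
      using \<tau> by (simp add: motion_def w d0 cav_speed_def[of _ _ _ 0] cav_dynamics)
    then show ?thesis by (intro exI)
  qed

  have properties: "platoon_gap P (p1 (tc + \<tau>)) (p2 (tc + \<tau>)) (v2 (tc + \<tau>)) = 0 \<and>
      within_bounds P tc tf v1 (cav_control up (tc + \<tau>)) \<and>
      tc + \<tau> + \<sigma> \<le> tf \<and> p1 (tc + \<tau> + \<sigma>) - p1 tc \<le> zone_length P"
    if m: "motion P tc x1 w1 x2 w2 up (tc + \<tau>) tf p1 v1 p2 v2 u2" for tf p1 v1 p2 v2 u2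
  proof -
    have init: "p1 tc = x1" "v1 tc = ?V" "p2 tc = x2" "v2 tc = ?V"
      and cav_dyn: "vehicle_dynamics tc tf p1 v1 (cav_control up (tc + \<tau>))"
      and hdv_dyn: "vehicle_dynamics tc tf p2 v2 u2"
      and free: "\<And>t. t \<in> {tc..tf} \<Longrightarrow> platoon_gap P (p1 t) (p2 t) (v2 t) > 0 \<Longrightarrow> v2 t = ?V"
      and tf: "tc < tf" "p1 tf - p1 tc = zone_length P"
      using m w by (auto simp: motion_def exit_time_def)
    have v1: "v1 t = cav_speed ?V up \<tau> (t - tc)" and p1: "p1 t = x1 + ?d (t - tc)"
      if "t \<in> {tc..tf}" for t
      using vehicle_dynamics_unique[OF cav_dyn cav_dynamics[of tc tf x1 ?V up \<tau> tc] _ _ that] init \<tau>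
      by (simp_all add: d0 cav_speed_def[of _ _ _ 0])
    \<comment> \<open>leaving before the formation time would mean a distance shorter than \<open>?d (\<tau> + \<sigma>)\<close>\<close>
    have tp: "tc + \<tau> + \<sigma> \<le> tf"
    proof (rule ccontr)
      assume "\<not> tc + \<tau> + \<sigma> \<le> tf"
      then have "?d (tf - tc) < ?d (\<tau> + \<sigma>)" using tf by (intro mono) auto
      then show False using p1[of tf] tf init formed by auto
    qed
    have "p1 (tc + \<tau> + \<sigma>) - p1 tc \<le> zone_length P"
      using p1[of "tc + \<tau> + \<sigma>"] tp \<tau> \<sigma> init formed by (simp add: add.assoc)
    moreover have "within_bounds P tc tf v1 (cav_control up (tc + \<tau>))"
      unfolding within_bounds_def
    proof
      fix t assume t: "t \<in> {tc..tf}"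
      have "low \<le> v1 t" "v1 t \<le> ?V"
        using cav_speed_bounds[of up "t - tc" \<tau> ?V] t up_neg \<tau> by (auto simp: v1[OF t] low_def)
      then show "v_min P \<le> v1 t \<and> v1 t \<le> ?V \<and> u_min P \<le> cav_control up (tc + \<tau>) t \<and>
          cav_control up (tc + \<tau>) t \<le> u_max P"
        using low up_min up_neg \<open>0 \<le> u_max P\<close> by (auto simp: cav_control_def)
    qed
    moreover have "platoon_gap P (p1 (tc + \<tau>)) (p2 (tc + \<tau>)) (v2 (tc + \<tau>)) = 0"
    proof (rule gap_closes_at_transition_end[OF hdv_dyn free _ _ _ up_eq up_neg \<tau>])
      show "p1 t = p1 tc + ?V * (t - tc) + up * (t - tc)\<^sup>2 / 2" if "t \<in> {tc..tc + \<tau>}" for t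
        using p1[of t] that tp \<sigma> init by (simp add: cav_travel_before)
    qed (use init \<delta> w tp \<sigma> in auto)
    ultimately show ?thesis using tp by simp
  qed

  show ?thesis
    unfolding feasible_def Let_def \<sigma>_def[symmetric] \<delta>(2)[symmetric]
    by (rule exI[of _ up], rule conjI[OF up_eq conjI[OF up_min conjI[OF up_neg conjI[OF existence]]]])
      (intro allI impI, rule properties)
qed

end
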